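(* Let $G=(V,E)$ be a connected simple graph with vertex set $V=[n]$ and edge set $E=\{e_1,\dots,e_m\}$, and let $G^{\tilde w}$ be a hyper-dual number weighted graph on $G$, with edge weights $\tilde w(e_k)=x_k+\Delta x_k(\varepsilon+\varepsilon^* )$, where $x_k>0$, $\Delta x_k\in\mathbb{R}$ and $x_k+\Delta x_k>0$ for all $k$. Let $\tilde L = L + L_1(\varepsilon+\varepsilon^* )$ be its Laplacian matrix. Then: (a) The Moore–Penrose inverse of $\tilde L$ exists and $$\tilde{L}^\dagger = L^\dagger - L^\dagger L_1 L^\dagger (\varepsilon + \varepsilon^* ) + 2L^\dagger L_1 L^\dagger L_1 L^\dagger \varepsilon \varepsilon^*.$$ (b) For all $i,j\in[n]$, $$R_{ij}(G^{\tilde{w}}) = (L^\dagger)^{(i,j)} - (L^\dagger L_1 L^\dagger)^{(i,j)} (\varepsilon + \varepsilon^* ) + 2(L^\dagger L_1 L^\dagger L_1 L^\dagger)^{(i,j)} \varepsilon \varepsilon^*.$$ (c) $$Kf(G^{\tilde{w}}) = n\,\mathrm{tr}(L^\dagger) - n\,\mathrm{tr}((L^\dagger)^2 L_1)(\varepsilon + \varepsilon^* ) + 2n\,\mathrm{tr}((L^\dagger)^2 L_1 L^\dagger L_1)\, \varepsilon \varepsilon^*.$$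
   Context: Hyper-dual numbers: $\tilde a = a + a_1\varepsilon + a_2\varepsilon^* + a_3\varepsilon\varepsilon^*$ with real $a,a_1,a_2,a_3$, where $\varepsilon^2=(\varepsilon^* )^2=0$, $\varepsilon\varepsilon^*=\varepsilon^*\varepsilon\ne0$; they form a commutative ring $\mathbb{H}$. For a hyper-dual matrix $\tilde A$, the Moore–Penrose inverse $\tilde A^\dagger$ is the (unique if existing) matrix $\tilde X$ with $\tilde A\tilde X\tilde A=\tilde A$, $\tilde X\tilde A\tilde X=\tilde X$, $(\tilde A\tilde X)^\top=\tilde A\tilde X$, $(\tilde X\tilde A)^\top=\tilde X\tilde A$; $L^\dagger$ is the usual Moore–Penrose inverse of a real matrix. The positive-weighted graph $G^w$ has edge weights $w(e_k)=x_k$; its adjacency matrix $A=(a_{st})$ has $a_{st}=w(e)$ if $e=\{s,t\}\in E$ and $0$ otherwise, degree matrix $D=\mathrm{diag}(d_1,\dots,d_n)$ with $d_s=\sum_t a_{st}$, and Laplacian $L=D-A$. Let $A_1=(\Delta a_{st})$ with $\Delta a_{st}=\Delta w(e)=\Delta x_k$ if $e=e_k=\{s,t\}\in E$ and $0$ otherwise, $D_1=\mathrm{diag}(\Delta d_1,\dots,\Delta d_n)$ with $\Delta d_s=\sum_t\Delta a_{st}$, and $L_1=D_1-A_1$. The adjacency matrix of $G^{\tilde w}$ is $\tilde A=A+A_1(\varepsilon+\varepsilon^* )$, its degree matrix $\tilde D=D+D_1(\varepsilon+\varepsilon^* )$, and its Laplacian $\tilde L=\tilde D-\tilde A=L+L_1(\varepsilon+\varepsilon^*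 )$. Resistance distance of $G^{\tilde w}$: $R_{ii}(G^{\tilde w})=0$; for $i\neq j$, view $G^{\tilde w}$ as an electrical network with resistance $1/\tilde a_{st}$ on each edge $\{s,t\}$; if a net current $Y\in\mathbb{H}$ (invertible, i.e. with nonzero real part) flows from $i$ to $j$ and $\mathbf v\in\mathbb{H}^n$ is a potential vector satisfying Kirchhoff's and Ohm's laws, i.e. $\tilde L\mathbf v=Y(\mathbf 1_i-\mathbf 1_j)$, then $R_{ij}(G^{\tilde w})=(v_i-v_j)/Y$. The Kirchhoff index is $Kf(G^{\tilde w})=\frac12\sum_{i,j=1}^n R_{ij}(G^{\tilde w})$. Notation: $\mathbf 1_i$ is the $i$-th standard unit vector; for a square matrix $P$, $P^{(i,j)}=P_{ii}+P_{jj}-P_{ij}-P_{ji}$. *)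

theory Defs
  imports "HOL-Analysis.Analysis"
begin

section \<open>Hyper-dual numbers\<close>

text \<open>\<open>HyperDual a a1 a2 a3\<close> stands for
  \<open>a + a1 \<epsilon> + a2 \<epsilon>\<^sup>* + a3 \<epsilon> \<epsilon>\<^sup>*\<close>.\<close>

datatype hyperdual =
  HyperDual (hd_re: real) (hd_e1: real) (hd_e2: real) (hd_e12: real)

lemma hyperdual_eq_iff:
  "p = q \<longleftrightarrow> hd_re p = hd_re q \<and> hd_e1 p = hd_e1 q \<and> hd_e2 p = hd_e2 q \<and> hd_e12 p = hd_e12 q"
  by (cases p; cases q) auto

instantiation hyperdual :: "{real_algebra_1, comm_ring_1}"
begin

definition zero_hyperdual :: hyperdual where "0 = HyperDual 0 0 0 0"

definition one_hyperdual :: hyperdual where "1 = HyperDual 1 0 0 0"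

definition plus_hyperdual :: "hyperdual \<Rightarrow> hyperdual \<Rightarrow> hyperdual" where
  "p + q = HyperDual (hd_re p + hd_re q) (hd_e1 p + hd_e1 q) (hd_e2 p + hd_e2 q) (hd_e12 p + hd_e12 q)"

definition uminus_hyperdual :: "hyperdual \<Rightarrow> hyperdual" where
  "- p = HyperDual (- hd_re p) (- hd_e1 p) (- hd_e2 p) (- hd_e12 p)"

definition minus_hyperdual :: "hyperdual \<Rightarrow> hyperdual \<Rightarrow> hyperdual" where
  "p - q = HyperDual (hd_re p - hd_re q) (hd_e1 p - hd_e1 q) (hd_e2 p - hd_e2 q) (hd_e12 p - hd_e12 q)"

definition times_hyperdual :: "hyperdual \<Rightarrow> hyperdual \<Rightarrow> hyperdual" where
  "p * q = HyperDual
     (hd_re p * hd_re q)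
     (hd_re p * hd_e1 q + hd_e1 p * hd_re q)
     (hd_re p * hd_e2 q + hd_e2 p * hd_re q)
     (hd_re p * hd_e12 q + hd_e1 p * hd_e2 q + hd_e2 p * hd_e1 q + hd_e12 p * hd_re q)"

definition scaleR_hyperdual :: "real \<Rightarrow> hyperdual \<Rightarrow> hyperdual" where
  "c *\<^sub>R p = HyperDual (c * hd_re p) (c * hd_e1 p) (c * hd_e2 p) (c * hd_e12 p)"

instance
  by standard
    (auto simp: hyperdual_eq_iff zero_hyperdual_def one_hyperdual_def plus_hyperdual_def
      uminus_hyperdual_def minus_hyperdual_def times_hyperdual_def scaleR_hyperdual_def
      algebra_simps)

end

lemma hyperdual_sel [simp]:
  "hd_re 0 = 0" "hd_e1 0 = 0" "hd_e2 0 = 0" "hd_e12 0 = 0"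
  "hd_re 1 = 1" "hd_e1 1 = 0" "hd_e2 1 = 0" "hd_e12 1 = 0"
  "hd_re (p + q) = hd_re p + hd_re q" "hd_e1 (p + q) = hd_e1 p + hd_e1 q"
  "hd_e2 (p + q) = hd_e2 p + hd_e2 q" "hd_e12 (p + q) = hd_e12 p + hd_e12 q"
  "hd_re (p - q) = hd_re p - hd_re q" "hd_e1 (p - q) = hd_e1 p - hd_e1 q"
  "hd_e2 (p - q) = hd_e2 p - hd_e2 q" "hd_e12 (p - q) = hd_e12 p - hd_e12 q"
  "hd_re (- p) = - hd_re p" "hd_e1 (- p) = - hd_e1 p"
  "hd_e2 (- p) = - hd_e2 p" "hd_e12 (- p) = - hd_e12 p"
  "hd_re (p * q) = hd_re p * hd_re q"
  "hd_e1 (p * q) = hd_re p * hd_e1 q + hd_e1 p * hd_re q"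
  "hd_e2 (p * q) = hd_re p * hd_e2 q + hd_e2 p * hd_re q"
  "hd_e12 (p * q) = hd_re p * hd_e12 q + hd_e1 p * hd_e2 q + hd_e2 p * hd_e1 q + hd_e12 p * hd_re q"
  "hd_re (c *\<^sub>R p) = c * hd_re p" "hd_e1 (c *\<^sub>R p) = c * hd_e1 p"
  "hd_e2 (c *\<^sub>R p) = c * hd_e2 p" "hd_e12 (c *\<^sub>R p) = c * hd_e12 p"
  "hd_re (of_real c) = c" "hd_e1 (of_real c) = 0" "hd_e2 (of_real c) = 0" "hd_e12 (of_real c) = 0"
  by (simp_all add: zero_hyperdual_def one_hyperdual_def plus_hyperdual_def uminus_hyperdual_def
      minus_hyperdual_def times_hyperdual_def scaleR_hyperdual_def of_real_def)

definition eps1 :: hyperdual where "eps1 = HyperDual 0 1 0 0"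

definition eps2 :: hyperdual where "eps2 = HyperDual 0 0 1 0"

lemma eps_sel [simp]:
  "hd_re eps1 = 0" "hd_e1 eps1 = 1" "hd_e2 eps1 = 0" "hd_e12 eps1 = 0"
  "hd_re eps2 = 0" "hd_e1 eps2 = 0" "hd_e2 eps2 = 1" "hd_e12 eps2 = 0"
  by (simp_all add: eps1_def eps2_def)

lemma eps_rules:
  "eps1 * eps1 = 0" "eps2 * eps2 = 0" "eps1 * eps2 = eps2 * eps1" "eps1 * eps2 \<noteq> 0"
  by (simp_all add: hyperdual_eq_iff)

lemma hyperdual_decomp:
  "HyperDual a a1 a2 a3 = of_real a + of_real a1 * eps1 + of_real a2 * eps2 + of_real a3 * (eps1 * eps2)"
  by (simp add: hyperdual_eq_iff)

text \<open>The inverse is meaningful only for units, that is, for nonzero real part.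
  The next two lemmas say that it is then the ring inverse.\<close>

instantiation hyperdual :: inverse
begin

definition inverse_hyperdual :: "hyperdual \<Rightarrow> hyperdual" where
  "inverse p = HyperDual
     (1 / hd_re p)
     (- hd_e1 p / (hd_re p)\<^sup>2)
     (- hd_e2 p / (hd_re p)\<^sup>2)
     (2 * hd_e1 p * hd_e2 p / (hd_re p) ^ 3 - hd_e12 p / (hd_re p)\<^sup>2)"

definition divide_hyperdual :: "hyperdual \<Rightarrow> hyperdual \<Rightarrow> hyperdual" where
  "p div q = p * inverse (q :: hyperdual)"

instance ..

end

lemma hyperdual_inverse_right:
  fixes p :: hyperdual
  assumes "hd_re p \<noteq> 0"
  shows "p * inverse p = 1"
  using assms
  by (simp add: hyperdual_eq_iff inverse_hyperdual_def field_simps power2_eq_square power3_eq_cube)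

lemma hyperdual_unit_iff: "p dvd 1 \<longleftrightarrow> hd_re p \<noteq> 0"
proof
  assume "p dvd 1"
  then obtain q where "1 = p * q" by (elim dvdE)
  then have "hd_re p * hd_re q = 1" by (metis hyperdual_sel(5,21))
  then show "hd_re p \<noteq> 0" by auto
next
  assume "hd_re p \<noteq> 0"
  then show "p dvd 1" by (metis hyperdual_inverse_right dvd_triv_left)
qed


section \<open>Moore--Penrose inverse\<close>

definition is_mp_inverse :: "'a::comm_ring_1^'n^'m \<Rightarrow> 'a^'m^'n \<Rightarrow> bool" where
  "is_mp_inverse A X \<longleftrightarrow>
     A ** X ** A = A \<and> X ** A ** X = X \<and>
     transpose (A ** X) = A ** X \<and> transpose (X ** A) = X ** A"

lemma is_mp_inverse_unique:
  assumes X: "is_mp_inverse A X" and Y: "is_mp_inverse A Y"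
  shows "X = Y"
proof -
  have x: "A ** X ** A = A" "X ** A ** X = X" "transpose (A ** X) = A ** X" "transpose (X ** A) = X ** A"
    and y: "A ** Y ** A = A" "Y ** A ** Y = Y" "transpose (A ** Y) = A ** Y" "transpose (Y ** A) = Y ** A"
    using X Y by (simp_all add: is_mp_inverse_def)
  have "A ** X = transpose ((A ** Y) ** (A ** X))"
    by (metis matrix_mul_assoc x(3) y(1))
  also have "\<dots> = (A ** X) ** (A ** Y)" by (metis matrix_transpose_mul x(3) y(3))
  finally have AX: "A ** X = A ** Y" by (metis matrix_mul_assoc x(1))
  have "X ** A = transpose ((X ** A) ** (Y ** A))"
    by (metis matrix_mul_assoc x(4) y(1))
  also have "\<dots> = (Y ** A) ** (X ** A)" by (metis matrix_transpose_mul x(4) y(4))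
  finally have XA: "X ** A = Y ** A" by (metis matrix_mul_assoc x(1))
  show "X = Y" by (metis AX XA matrix_mul_assoc x(2) y(2))
qed

text \<open>Over the hyper-dual numbers a Moore--Penrose inverse need not exist, so the
  value below is meaningful only together with an existence statement.\<close>

definition mp_inverse :: "'a::comm_ring_1^'n^'m \<Rightarrow> 'a^'m^'n" where
  "mp_inverse A = (THE X. is_mp_inverse A X)"


section \<open>Weighted graphs\<close>

text \<open>The vertex set is the whole finite type \<open>'n\<close>, and a graph is given by its set of edges,
  which are two-element vertex sets. Weights are functions on edges; their values off the
  edge set are irrelevant.\<close>

definition simple_graph :: "'n set set \<Rightarrow> bool" where
  "simple_graph E \<longleftrightarrow> (\<forall>e\<in>E. card e = 2)"

definition graph_connected :: "'n set set \<Rightarrow> bool" where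
  "graph_connected E \<longleftrightarrow> (\<forall>s t. (s, t) \<in> {(u, v). {u, v} \<in> E}\<^sup>*)"

definition adjacency_matrix :: "'n::finite set set \<Rightarrow> ('n set \<Rightarrow> 'a::comm_ring_1) \<Rightarrow> 'a^'n^'n" where
  "adjacency_matrix E w = (\<chi> s t. if {s, t} \<in> E then w {s, t} else 0)"

definition degree_matrix :: "'n::finite set set \<Rightarrow> ('n set \<Rightarrow> 'a::comm_ring_1) \<Rightarrow> 'a^'n^'n" where
  "degree_matrix E w = (\<chi> s t. if s = t then (\<Sum>u\<in>UNIV. adjacency_matrix E w $ s $ u) else 0)"

definition laplacian :: "'n::finite set set \<Rightarrow> ('n set \<Rightarrow> 'a::comm_ring_1) \<Rightarrow> 'a^'n^'n" where
  "laplacian E w = degree_matrix E w - adjacency_matrix E w"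

definition hd_weight :: "('n set \<Rightarrow> real) \<Rightarrow> ('n set \<Rightarrow> real) \<Rightarrow> 'n set \<Rightarrow> hyperdual" where
  "hd_weight x dx e = of_real (x e) + of_real (dx e) * (eps1 + eps2)"

definition matrix_scale :: "'a::times \<Rightarrow> 'a^'n^'m \<Rightarrow> 'a^'n^'m"  (infixl \<open>*ss\<close> 70) where
  "c *ss A = (\<chi> s t. c * A $ s $ t)"

abbreviation hd_matrix :: "real^'n^'m \<Rightarrow> hyperdual^'n^'m" where
  "hd_matrix \<equiv> map_matrix of_real"

lemma laplacian_hd_weight:
  "laplacian E (hd_weight x dx) =
     hd_matrix (laplacian E x) + (eps1 + eps2) *ss hd_matrix (laplacian E dx)"
proof -
  have *: "adjacency_matrix E (hd_weight x dx) $ s $ t =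
      of_real (adjacency_matrix E x $ s $ t) + (eps1 + eps2) * of_real (adjacency_matrix E dx $ s $ t)"
    for s t
    by (simp add: adjacency_matrix_def hd_weight_def mult.commute)
  show ?thesis
    by (simp add: vec_eq_iff laplacian_def degree_matrix_def * map_matrix_def
        matrix_scale_def sum.distrib sum_distrib_left algebra_simps)
qed


section \<open>Resistance distance and Kirchhoff index\<close>

text \<open>\<open>v\<close> is a potential for a net current \<open>Y\<close> from \<open>i\<close> to \<open>j\<close>
  if \<open>laplacian E w *v v = Y *s (axis i 1 - axis j 1)\<close>. The description operator
  has a determined value only if a solution with invertible \<open>Y\<close> exists and all
  such solutions yield the same quotient.\<close>

definition resistance :: "'n::finite set set \<Rightarrow> ('n set \<Rightarrow> hyperdual) \<Rightarrow> 'n \<Rightarrow> 'n \<Rightarrow> hyperdual" where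
  "resistance E w i j =
     (if i = j then 0
      else THE r. \<exists>Y v. Y dvd 1 \<and> laplacian E w *v v = Y *s (axis i 1 - axis j 1) \<and>
                    r = (v $ i - v $ j) / Y)"

definition kirchhoff_index :: "'n::finite set set \<Rightarrow> ('n set \<Rightarrow> hyperdual) \<Rightarrow> hyperdual" where
  "kirchhoff_index E w = (1 / 2) *\<^sub>R (\<Sum>i\<in>UNIV. \<Sum>j\<in>UNIV. resistance E w i j)"

text \<open>The usual notation is \<open>P^(i,j)\<close>.\<close>

definition pair_entry :: "'a::ring^'n^'n \<Rightarrow> 'n \<Rightarrow> 'n \<Rightarrow> 'a" where
  "pair_entry P i j = P $ i $ i + P $ j $ j - P $ i $ j - P $ j $ i"

end

theory Submission
  imports Defs
begin

text \<open>Let \<open>J\<close> (here \<open>averaging\<close>) be the matrix with all entries \<open>1/n\<close>. Every weighted Laplacian annihilates the constant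
  vectors from both sides, and for positive weights on a connected graph these span the kernel.
  Hence \<open>L + J\<close> is invertible and \<open>(L + J)\<^sup>-\<^sup>1 - J\<close> is the Moore--Penrose inverse of \<open>L\<close>; it is
  characterised by being a two-sided inverse of \<open>L\<close> modulo \<open>J\<close>. As \<open>(\<epsilon> + \<epsilon>\<^sup>*)\<^sup>3 = 0\<close>, the Neumann
  series of the perturbed inverse stops after three terms. Given such a generalised inverse \<open>Z\<close>
  with \<open>L Z = Z L = I - J\<close>, the potentials for a current \<open>Y\<close> from \<open>i\<close> to \<open>j\<close> are
  \<open>Y Z (1\<^sub>i - 1\<^sub>j)\<close> up to constants, which yields the resistances, and summing them with
  \<open>J Z = 0\<close> yields the Kirchhoff index.\<close>

section \<open>Matrix algebra\<close>

lemma matrix_add_rdistrib: "(A + B) ** C = A ** C + B ** (C :: 'a::semiring_1^'k^'n)"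
  by (simp add: vec_eq_iff matrix_matrix_mult_def distrib_right sum.distrib)

lemma matrix_sub_ldistrib: "A ** (B - C) = A ** B - A ** (C :: 'a::ring_1^'k^'n)"
  by (simp add: vec_eq_iff matrix_matrix_mult_def right_diff_distrib sum_subtractf)

lemma matrix_sub_rdistrib: "(A - B) ** C = A ** C - B ** (C :: 'a::ring_1^'k^'n)"
  by (simp add: vec_eq_iff matrix_matrix_mult_def left_diff_distrib sum_subtractf)

lemma matrix_scale_mult_left: "(c *ss A) ** B = c *ss (A ** (B :: 'a::comm_ring_1^'k^'n))"
  by (simp add: vec_eq_iff matrix_scale_def matrix_matrix_mult_def sum_distrib_left mult.assoc)

lemma matrix_scale_mult_right: "A ** (c *ss B) = c *ss (A ** (B :: 'a::comm_ring_1^'k^'n))"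
  by (simp add: vec_eq_iff matrix_scale_def matrix_matrix_mult_def sum_distrib_left mult.left_commute)

lemma matrix_scale_scale: "c *ss (d *ss A) = (c * d) *ss (A :: 'a::comm_ring_1^'k^'n)"
  by (simp add: vec_eq_iff matrix_scale_def mult.assoc)

lemma matrix_scale_add: "c *ss (A + B) = c *ss A + c *ss (B :: 'a::comm_ring_1^'k^'n)"
  by (simp add: vec_eq_iff matrix_scale_def distrib_left)

lemma matrix_scale_diff: "c *ss (A - B) = c *ss A - c *ss (B :: 'a::comm_ring_1^'k^'n)"
  by (simp add: vec_eq_iff matrix_scale_def right_diff_distrib)

lemma matrix_scale_zero: "0 *ss A = (0 :: 'a::comm_ring_1^'k^'n)"
  by (simp add: vec_eq_iff matrix_scale_def)

lemma trace_matrix_scale: "trace (c *ss A) = c * trace (A :: 'a::comm_ring_1^'n^'n)"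
  by (simp add: trace_def matrix_scale_def sum_distrib_left)

lemma pair_entry_add: "pair_entry (A + B) i j = pair_entry A i j + pair_entry B i j"
  by (simp add: pair_entry_def)

lemma pair_entry_diff: "pair_entry (A - B) i j = pair_entry A i j - pair_entry B i j"
  by (simp add: pair_entry_def)

lemma pair_entry_scale:
  "pair_entry (c *ss A) i j = c * pair_entry (A :: 'a::comm_ring_1^'n^'n) i j"
  by (simp add: pair_entry_def matrix_scale_def algebra_simps)

lemma pair_entry_hd_matrix: "pair_entry (hd_matrix A) i j = of_real (pair_entry A i j)"
  by (simp add: pair_entry_def map_matrix_def)

lemma trace_hd_matrix: "trace (hd_matrix A) = of_real (trace A)"
  by (simp add: trace_def map_matrix_def)

lemma hd_matrix_mult: "hd_matrix (A ** B) = hd_matrix A ** hd_matrix B"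
  by (simp add: vec_eq_iff map_matrix_def matrix_matrix_mult_def)

lemma matrix_mult_matvec_axis_diff:
  "(A *v (axis i 1 - axis j 1)) $ s = A $ s $ i - (A :: 'a::comm_ring_1^'n^'m) $ s $ j"
  by (simp add: matrix_vector_mult_def axis_def right_diff_distrib sum_subtractf
      if_distrib[of "(*) _"] cong: if_cong)

text \<open>The resolvent identity in a form where \<open>X\<close> inverts \<open>A\<close> only on the range of \<open>P\<close>.\<close>

lemma perturbed_inverse_right:
  fixes A B P X :: "'a::comm_ring_1^'n^'n"
  assumes AX: "A ** X = P" and PB: "P ** B = B" and "c * c * c = 0"
  shows "(A + c *ss B) **
      (X - c *ss (X ** B ** X) + (c * c) *ss (X ** B ** X ** B ** X)) = P"
proof -
  have 1: "A ** X ** B = B" by (simp add: AX PB)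
  \<comment> \<open>In right-associated form \<open>A ** X ** B\<close> occurs only in front of a
    further factor, which the rewrite rule has to absorb.\<close>
  have 2: "A ** (X ** (B ** Y)) = B ** Y" for Y :: "'a^'n^'n"
    using 1 by (simp add: matrix_mul_assoc)
  show ?thesis
    by (simp add: matrix_add_ldistrib matrix_add_rdistrib matrix_sub_ldistrib matrix_sub_rdistrib
        matrix_scale_mult_left matrix_scale_mult_right matrix_scale_scale matrix_scale_zero
        matrix_scale_add matrix_scale_diff
        matrix_mul_assoc[symmetric] 2 AX assms(3) mult.assoc[symmetric])
qed

text \<open>The sum telescopes: \<open>B ** (X ** A) = B\<close> cancels the terms of orders
  \<open>c\<close> and \<open>c * c\<close>, and what remains beyond \<open>P\<close> carries
  \<open>c * c * c\<close>.\<close>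

lemma perturbed_inverse_left:
  fixes A B P X :: "'a::comm_ring_1^'n^'n"
  assumes XA: "X ** A = P" and BP: "B ** P = B" and "c * c * c = 0"
  shows "(X - c *ss (X ** B ** X) + (c * c) *ss (X ** B ** X ** B ** X)) **
      (A + c *ss B) = P"
proof -
  have 1: "B ** (X ** A) = B" by (simp add: XA BP)
  show ?thesis
    by (simp add: matrix_add_ldistrib matrix_add_rdistrib matrix_sub_ldistrib matrix_sub_rdistrib
        matrix_scale_mult_left matrix_scale_mult_right matrix_scale_scale matrix_scale_zero
        matrix_scale_add matrix_scale_diff
        matrix_mul_assoc[symmetric] 1 XA BP assms(3) mult.assoc[symmetric])
qed

section \<open>The averaging matrix\<close>

text \<open>The projection onto the constant vectors. The general scalar type serves real and
  hyper-dual matrices alike.\<close>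

definition averaging :: "'a::{real_algebra_1,comm_ring_1}^'n::finite^'n" where
  "averaging = (\<chi> s t. of_real (1 / real CARD('n)))"

lemma averaging_vec: "(averaging *v v) $ s = of_real (1 / real CARD('n)) * sum (($) v) UNIV"
  for v :: "'a::{real_algebra_1,comm_ring_1}^'n::finite"
  by (simp add: averaging_def matrix_vector_mult_def sum_distrib_left)

lemma averaging_mult:
  "(averaging ** A) $ s $ t = of_real (1 / real CARD('n)) * (\<Sum>u\<in>UNIV. A $ u $ t)"
  for A :: "'a::{real_algebra_1,comm_ring_1}^'k^'n::finite"
  by (simp add: averaging_def matrix_matrix_mult_def sum_distrib_left)

lemma mult_averaging:
  "(A ** averaging) $ s $ t = (\<Sum>u\<in>UNIV. A $ s $ u) * of_real (1 / real CARD('n))"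
  for A :: "'a::{real_algebra_1,comm_ring_1}^'n::finite^'k"
  by (simp add: averaging_def matrix_matrix_mult_def sum_distrib_right)

lemma averaging_idem:
  "averaging ** averaging = (averaging :: 'a::{real_algebra_1,comm_ring_1}^'n::finite^'n)"
proof -
  have "of_nat CARD('n) * of_real (inverse (real CARD('n))) = (1::'a)"
    by (metis of_real_mult of_real_of_nat_eq of_real_1 right_inverse of_nat_eq_0_iff
        zero_less_card_finite less_not_refl)
  then show ?thesis
    by (simp add: vec_eq_iff averaging_mult) (simp add: averaging_def inverse_eq_divide)
qed

lemma hd_matrix_centering:
  "hd_matrix (mat 1 - averaging :: real^'n::finite^'n) = mat 1 - averaging"
  by (simp add: vec_eq_iff map_matrix_def averaging_def mat_def)

lemma column_sums_zero:
  fixes A :: "'a::{real_algebra_1,comm_ring_1}^'k^'n::finite"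
  assumes "averaging ** A = 0"
  shows "(\<Sum>u\<in>UNIV. A $ u $ t) = 0"
proof -
  \<comment> \<open>Hyper-dual numbers have zero divisors, so the factor is cancelled as a real
    scalar. All rows of \<open>averaging ** A\<close> agree, hence the arbitrary row index.\<close>
  have "(1 / real CARD('n)) *\<^sub>R (\<Sum>u\<in>UNIV. A $ u $ t) = 0"
    using arg_cong[OF assms, of "\<lambda>M. M $ undefined $ t"] by (simp add: averaging_mult scaleR_conv_of_real)
  then show ?thesis by simp
qed

text \<open>Both products equal the same symmetric matrix, which fixes every matrix annihilated by
  \<open>averaging\<close> from the left.\<close>

lemma is_mp_inverse_centering:
  assumes "A ** X = mat 1 - averaging" "X ** A = mat 1 - averaging"
    and "averaging ** A = 0" "averaging ** X = 0"
  shows "is_mp_inverse A (X :: 'a::{real_algebra_1,comm_ring_1}^'n::finite^'n)"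
proof -
  have "transpose (mat 1 - averaging) = (mat 1 - averaging :: 'a^'n^'n)"
    by (simp add: vec_eq_iff transpose_def averaging_def mat_def)
  then show ?thesis
    by (simp add: is_mp_inverse_def assms matrix_sub_rdistrib)
qed

section \<open>Laplacians\<close>

lemma adjacency_matrix_commute: "adjacency_matrix E w $ s $ t = adjacency_matrix E w $ t $ s"
  by (simp add: adjacency_matrix_def insert_commute)

lemma laplacian_commute: "laplacian E w $ s $ t = laplacian E w $ t $ s"
  by (simp add: laplacian_def degree_matrix_def adjacency_matrix_commute[of E w s t])

lemma laplacian_row_sum: "(\<Sum>t\<in>UNIV. laplacian E w $ s $ t) = 0"
  by (simp add: laplacian_def degree_matrix_def sum_subtractf)

lemma laplacian_averaging: "laplacian E w ** averaging = 0"
  by (simp add: vec_eq_iff mult_averaging laplacian_row_sum)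

lemma averaging_laplacian: "averaging ** laplacian E w = 0"
  by (simp add: vec_eq_iff averaging_mult laplacian_commute[of E w _ t for t] laplacian_row_sum)

lemma laplacian_vec:
  "(laplacian E w *v v) $ s = (\<Sum>t\<in>UNIV. adjacency_matrix E w $ s $ t * (v $ s - v $ t))"
proof -
  have "(\<Sum>t\<in>UNIV. degree_matrix E w $ s $ t * v $ t)
      = (\<Sum>t\<in>UNIV. if s = t then (\<Sum>u\<in>UNIV. adjacency_matrix E w $ s $ u) * v $ t else 0)"
    by (intro sum.cong) (auto simp: degree_matrix_def)
  then show ?thesis
    by (simp add: laplacian_def matrix_vector_mult_def left_diff_distrib right_diff_distrib
        sum_subtractf sum_distrib_right)
qed

text \<open>Adding the double sum to its copy with \<open>s\<close> and \<open>t\<close> exchanged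
  turns \<open>v $ s * (v $ s - v $ t)\<close> into a square. The factor 2 stays on the left because
  the ring may lack 1/2.\<close>

lemma laplacian_quadratic_form:
  fixes v :: "'a::comm_ring_1^'n::finite"
  shows "2 * (\<Sum>s\<in>UNIV. v $ s * (laplacian E w *v v) $ s)
    = (\<Sum>s\<in>UNIV. \<Sum>t\<in>UNIV. adjacency_matrix E w $ s $ t * (v $ s - v $ t)\<^sup>2)"
proof -
  let ?a = "\<lambda>s t. adjacency_matrix E w $ s $ t"
  let ?q = "\<Sum>s\<in>UNIV. v $ s * (laplacian E w *v v) $ s"
  have q: "?q = (\<Sum>s\<in>UNIV. \<Sum>t\<in>UNIV. ?a s t * (v $ s * (v $ s - v $ t)))"
    by (simp add: laplacian_vec sum_distrib_left mult.left_commute)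
  have q': "?q = (\<Sum>s\<in>UNIV. \<Sum>t\<in>UNIV. ?a s t * (v $ t * (v $ t - v $ s)))"
    unfolding q by (subst sum.swap) (simp add: adjacency_matrix_commute[of E w])
  have "2 * ?q = ?q + ?q" by simp
  also have "\<dots> = (\<Sum>s\<in>UNIV. \<Sum>t\<in>UNIV. ?a s t * (v $ s - v $ t)\<^sup>2)"
    by (subst (1) q, subst q')
      (simp add: sum.distrib[symmetric] power2_eq_square algebra_simps)
  finally show ?thesis .
qed

text \<open>A vanishing sum of nonnegative terms makes \<open>v\<close> agree across each edge,
  hence along each path.\<close>

lemma laplacian_kernel:
  fixes v :: "real^'n::finite"
  assumes conn: "graph_connected E" and pos: "\<And>e. e \<in> E \<Longrightarrow> x e > 0"
    and ker: "laplacian E x *v v = 0"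
  shows "v $ s = v $ t"
proof -
  have nonneg: "adjacency_matrix E x $ p $ q * (v $ p - v $ q)\<^sup>2 \<ge> 0" for p q
    using pos by (simp add: adjacency_matrix_def less_imp_le)
  have "(\<Sum>p\<in>UNIV. \<Sum>q\<in>UNIV. adjacency_matrix E x $ p $ q * (v $ p - v $ q)\<^sup>2) = 0"
    using laplacian_quadratic_form[of v E x] ker by simp
  then have zero: "adjacency_matrix E x $ p $ q * (v $ p - v $ q)\<^sup>2 = 0" for p q
    by (simp add: sum_nonneg_eq_0_iff sum_nonneg nonneg)
  have edge: "v $ p = v $ q" if "{p, q} \<in> E" for p q
    using zero[of p q] pos[OF that] that by (simp add: adjacency_matrix_def)
  have "(s, t) \<in> {(p, q). {p, q} \<in> E}\<^sup>*"
    using conn by (simp add: graph_connected_def)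
  then show ?thesis
    by induction (auto dest: edge)
qed

lemma laplacian_mp_inverse:
  fixes E :: "'n::finite set set" and x :: "'n set \<Rightarrow> real"
  assumes "graph_connected E" and "\<And>e. e \<in> E \<Longrightarrow> x e > 0"
  defines "L \<equiv> laplacian E x"
  shows "L ** mp_inverse L = mat 1 - averaging" "mp_inverse L ** L = mat 1 - averaging"
    "averaging ** mp_inverse L = 0"
proof -
  let ?J = "averaging :: real^'n^'n"
  have LJ: "L ** ?J = 0" and JL: "?J ** L = 0"
    by (simp_all add: L_def laplacian_averaging averaging_laplacian)
  have "v = 0" if v: "(L + ?J) *v v = 0" for v
  proof -
    \<comment> \<open>Multiplying by \<open>?J\<close> separates the two summands:
      \<open>?J ** (L + ?J) = ?J\<close>, so \<open>?J *v v\<close> and then \<open>L *v v\<close>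
      vanish. Thus \<open>v\<close> is constant with sum zero.\<close>
    have "?J *v v = (?J ** (L + ?J)) *v v"
      by (simp add: matrix_add_ldistrib JL averaging_idem)
    also have "\<dots> = 0"
      using v by (simp flip: matrix_vector_mul_assoc)
    finally have Jv: "?J *v v = 0" .
    then have "L *v v = 0"
      using v by (simp add: matrix_vector_mult_add_rdistrib)
    then have const: "v $ s = v $ t" for s t
      using laplacian_kernel[of E x] assms by blast
    have "v $ s = 0" for s
    proof -
      have "(\<Sum>t\<in>UNIV. v $ t) = 0"
        using arg_cong[OF Jv, of "\<lambda>u. u $ s"] by (simp add: averaging_vec)
      moreover have "(\<Sum>t\<in>UNIV. v $ t) = (\<Sum>t\<in>(UNIV::'n set). v $ s)"
        by (intro sum.cong refl const)
      ultimately show ?thesis by simp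
    qed
    then show "v = 0" by (simp add: vec_eq_iff)
  qed
  then obtain M where inv_left: "M ** (L + ?J) = mat 1"
    using matrix_left_invertible_ker[of "L + ?J"] by blast
  then have inv_right: "(L + ?J) ** M = mat 1"
    by (simp add: matrix_left_right_inverse)
  have "M ** ?J = M ** ((L + ?J) ** ?J)"
    by (simp add: matrix_add_rdistrib LJ averaging_idem)
  then have MJ: "M ** ?J = ?J" by (simp add: matrix_mul_assoc inv_left)
  have "?J ** M = (?J ** (L + ?J)) ** M"
    by (simp add: matrix_add_ldistrib JL averaging_idem)
  then have JM: "?J ** M = ?J" by (simp add: matrix_mul_assoc[symmetric] inv_right)
  \<comment> \<open>\<open>M\<close> acts as the identity on constant vectors; subtracting
    \<open>?J\<close> removes this part and leaves the inverse of \<open>L\<close> on vectors with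
    sum zero.\<close>
  define X where "X = M - ?J"
  have X: "L ** X = mat 1 - ?J" "X ** L = mat 1 - ?J" "?J ** X = 0"
    using inv_left inv_right by (simp_all add: X_def matrix_sub_ldistrib matrix_sub_rdistrib
        matrix_add_ldistrib matrix_add_rdistrib LJ JL JM MJ averaging_idem algebra_simps)
  have "is_mp_inverse L X"
    by (rule is_mp_inverse_centering) (simp_all add: X JL)
  then have "mp_inverse L = X"
    unfolding mp_inverse_def by (blast intro: is_mp_inverse_unique)
  with X show "L ** mp_inverse L = mat 1 - averaging" "mp_inverse L ** L = mat 1 - averaging"
    "averaging ** mp_inverse L = 0" by simp_all
qed

section \<open>Resistances\<close>

lemma resistance_eq_pair_entry:
  assumes LZ: "laplacian E w ** Z = mat 1 - averaging"
    and ZL: "Z ** laplacian E w = mat 1 - averaging"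
  shows "resistance E w i j = pair_entry Z i j"
proof (cases "i = j")
  case True
  then show ?thesis by (simp add: resistance_def pair_entry_def)
next
  case False
  let ?b = "axis i 1 - axis j 1 :: hyperdual^'a"
  have "(THE r. \<exists>Y v. Y dvd 1 \<and> laplacian E w *v v = Y *s ?b \<and> r = (v $ i - v $ j) / Y)
      = pair_entry Z i j"
  proof (rule the_equality)
    \<comment> \<open>The injected current is balanced, so \<open>mat 1 - averaging\<close> fixes
      \<open>?b\<close>, and \<open>Z *v ?b\<close> is a potential for unit current.\<close>
    have "averaging *v ?b = 0"
      by (simp add: vec_eq_iff averaging_vec sum_subtractf axis_def)
    then have "laplacian E w *v (Z *v ?b) = 1 *s ?b"
      by (simp add: matrix_vector_mul_assoc LZ matrix_vector_mult_diff_rdistrib)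
    moreover have "pair_entry Z i j = ((Z *v ?b) $ i - (Z *v ?b) $ j) / 1"
      by (simp add: matrix_mult_matvec_axis_diff pair_entry_def divide_hyperdual_def
          inverse_hyperdual_def hyperdual_eq_iff)
    ultimately show "\<exists>Y v. Y dvd 1 \<and> laplacian E w *v v = Y *s ?b
        \<and> pair_entry Z i j = (v $ i - v $ j) / Y"
      using one_dvd by blast
  next
    fix r
    assume "\<exists>Y v. Y dvd 1 \<and> laplacian E w *v v = Y *s ?b \<and> r = (v $ i - v $ j) / Y"
    then obtain Y v where Y: "Y dvd 1" and v: "laplacian E w *v v = Y *s ?b"
      and r: "r = (v $ i - v $ j) / Y" by blast
    \<comment> \<open>Applying \<open>Z\<close> to the network equation recovers \<open>v\<close> up
      to its mean, which cancels in \<open>v $ i - v $ j\<close>.\<close>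
    have "v - averaging *v v = Z *v (laplacian E w *v v)"
      by (simp add: matrix_vector_mul_assoc ZL matrix_vector_mult_diff_rdistrib)
    also have "\<dots> = Y *s (Z *v ?b)"
      unfolding v by (simp only: matrix_vector_mult_def vec_eq_iff vec_lambda_beta
          vector_smult_component sum_distrib_left mult.left_commute) simp
    finally have *: "v $ s - (averaging *v v) $ s = Y * (Z $ s $ i - Z $ s $ j)" for s
      by (metis vector_minus_component vector_smult_component matrix_mult_matvec_axis_diff)
    have "v $ i - v $ j = (v $ i - (averaging *v v) $ i) - (v $ j - (averaging *v v) $ j)"
      by (simp add: averaging_vec)
    also have "\<dots> = Y * pair_entry Z i j"
      unfolding * by (simp add: pair_entry_def algebra_simps)
    finally have "v $ i - v $ j = Y * pair_entry Z i j" .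
    moreover have "Y * inverse Y = 1"
      using Y by (simp add: hyperdual_inverse_right hyperdual_unit_iff)
    ultimately show "r = pair_entry Z i j"
      by (simp add: r divide_hyperdual_def) (metis mult.commute mult.left_commute mult_1_right)
  qed
  with False show ?thesis by (simp add: resistance_def)
qed

text \<open>Each of the two diagonal terms of \<open>pair_entry\<close> contributes
  \<open>CARD('n)\<close> times the trace; the mixed terms add up to the sum of all entries of
  \<open>Z\<close>, which is zero since its columns sum to zero.\<close>

lemma kirchhoff_index_eq_trace:
  fixes Z :: "hyperdual^'n::finite^'n"
  assumes LZ: "laplacian E w ** Z = mat 1 - averaging"
    and ZL: "Z ** laplacian E w = mat 1 - averaging"
    and JZ: "averaging ** Z = 0"
  shows "kirchhoff_index E w = of_nat CARD('n) * trace Z"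
proof -
  have 1: "(\<Sum>i\<in>UNIV. \<Sum>j\<in>UNIV. Z $ j $ i) = 0"
    by (simp add: column_sums_zero[OF JZ])
  have 2: "(\<Sum>i\<in>UNIV. \<Sum>j\<in>UNIV. Z $ i $ j) = 0"
    by (subst sum.swap) (rule 1)
  have "(\<Sum>i\<in>UNIV. \<Sum>j\<in>UNIV. resistance E w i j)
      = 2 * (of_nat CARD('n) * trace Z)"
    by (simp add: resistance_eq_pair_entry[OF LZ ZL] pair_entry_def sum.distrib sum_subtractf 1 2
        trace_def sum_distrib_left)
  also have "\<dots> = 2 *\<^sub>R (of_nat CARD('n) * trace Z)"
    by (simp add: scaleR_2)
  finally show ?thesis by (simp add: kirchhoff_index_def)
qed

theorem theorem3p1:
  fixes E :: "'n::finite set set"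
    and x dx :: "'n set \<Rightarrow> real"
    and L L1 Ld :: "real^'n^'n"
    and w :: "'n set \<Rightarrow> hyperdual"
  assumes "simple_graph E"
    and "graph_connected E"
    and "\<And>e. e \<in> E \<Longrightarrow> x e > 0"
    and "\<And>e. e \<in> E \<Longrightarrow> x e + dx e > 0"
    and "w = hd_weight x dx"
    and "L = laplacian E x"
    and "L1 = laplacian E dx"
    and "Ld = mp_inverse L"
  shows "((\<exists>X. is_mp_inverse (laplacian E w) X) \<and>
      mp_inverse (laplacian E w) =
        hd_matrix Ld
        - (eps1 + eps2) *ss hd_matrix (Ld ** L1 ** Ld)
        + (2 * (eps1 * eps2)) *ss hd_matrix (Ld ** L1 ** Ld ** L1 ** Ld)) \<and>
    (\<forall>i j. resistance E w i j =
        of_real (pair_entry Ld i j)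
        - of_real (pair_entry (Ld ** L1 ** Ld) i j) * (eps1 + eps2)
        + 2 * of_real (pair_entry (Ld ** L1 ** Ld ** L1 ** Ld) i j) * (eps1 * eps2)) \<and>
    kirchhoff_index E w =
        of_nat CARD('n) * of_real (trace Ld)
        - of_nat CARD('n) * of_real (trace (Ld ** Ld ** L1)) * (eps1 + eps2)
        + 2 * of_nat CARD('n) * of_real (trace (Ld ** Ld ** L1 ** Ld ** L1)) * (eps1 * eps2)"
proof -
  let ?e = "eps1 + eps2" and ?L = "hd_matrix L" and ?L1 = "hd_matrix L1" and ?X = "hd_matrix Ld"
  define Z where "Z = ?X - ?e *ss hd_matrix (Ld ** L1 ** Ld)
      + (2 * (eps1 * eps2)) *ss hd_matrix (Ld ** L1 ** Ld ** L1 ** Ld)"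
  \<comment> \<open>Here the coefficient 2 of the final formulas arises. The facts instantiated at
    \<open>2\<close> give the components of the numeral.\<close>
  have ee: "?e * ?e = 2 * (eps1 * eps2)" and eee: "?e * ?e * ?e = 0"
    using hyperdual_sel(29-32)[of 2] by (simp_all add: hyperdual_eq_iff)
  have real: "L ** Ld = mat 1 - averaging" "Ld ** L = mat 1 - averaging" "averaging ** Ld = 0"
    using laplacian_mp_inverse[of E x] assms by simp_all
  have hd: "?L ** ?X = mat 1 - averaging" "?X ** ?L = mat 1 - averaging"
    by (simp_all flip: hd_matrix_mult add: real hd_matrix_centering)
  \<comment> \<open>Rows and columns of a Laplacian sum to zero whatever the signs of the weights,
    so centering fixes \<open>?L1\<close>.\<close>
  have cent: "(mat 1 - averaging) ** ?L1 = ?L1" "?L1 ** (mat 1 - averaging) = ?L1"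
    unfolding hd_matrix_centering[symmetric] hd_matrix_mult[symmetric]
    by (simp_all add: assms(7) matrix_sub_ldistrib matrix_sub_rdistrib laplacian_averaging
        averaging_laplacian)
  have Z: "Z = ?X - ?e *ss (?X ** ?L1 ** ?X) + (?e * ?e) *ss (?X ** ?L1 ** ?X ** ?L1 ** ?X)"
    by (simp add: Z_def ee hd_matrix_mult)
  have lap: "laplacian E w = ?L + ?e *ss ?L1"
    by (simp add: assms(5-7) laplacian_hd_weight)
  have LZ: "laplacian E w ** Z = mat 1 - averaging"
    unfolding lap Z by (rule perturbed_inverse_right[OF hd(1) cent(1) eee])
  have ZL: "Z ** laplacian E w = mat 1 - averaging"
    unfolding lap Z by (rule perturbed_inverse_left[OF hd(2) cent(2) eee])
  have "hd_matrix (averaging ** Ld) = 0"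
    by (simp add: real vec_eq_iff map_matrix_def)
  moreover have "hd_matrix averaging = (averaging :: hyperdual^'n^'n)"
    by (simp add: vec_eq_iff map_matrix_def averaging_def)
  ultimately have JX: "averaging ** ?X = 0"
    by (simp add: hd_matrix_mult)
  \<comment> \<open>Every summand of \<open>Z\<close> has \<open>?X\<close> as its leftmost matrix
    factor.\<close>
  have JZ: "averaging ** Z = 0"
    unfolding Z by (simp add: matrix_add_ldistrib matrix_sub_ldistrib matrix_scale_mult_right
        matrix_mul_assoc JX) (simp add: vec_eq_iff matrix_scale_def)
  have mp: "is_mp_inverse (laplacian E w) Z"
    by (rule is_mp_inverse_centering[OF LZ ZL averaging_laplacian JZ])
  then have "mp_inverse (laplacian E w) = Z"
    unfolding mp_inverse_def by (blast intro: is_mp_inverse_unique)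
  moreover have "resistance E w i j =
        of_real (pair_entry Ld i j)
        - of_real (pair_entry (Ld ** L1 ** Ld) i j) * ?e
        + 2 * of_real (pair_entry (Ld ** L1 ** Ld ** L1 ** Ld) i j) * (eps1 * eps2)" for i j
    unfolding resistance_eq_pair_entry[OF LZ ZL] Z_def
    by (simp add: pair_entry_add pair_entry_diff pair_entry_scale pair_entry_hd_matrix ac_simps)
  moreover have "kirchhoff_index E w =
        of_nat CARD('n) * of_real (trace Ld)
        - of_nat CARD('n) * of_real (trace (Ld ** Ld ** L1)) * ?e
        + 2 * of_nat CARD('n) * of_real (trace (Ld ** Ld ** L1 ** Ld ** L1)) * (eps1 * eps2)"
  proof -
    \<comment> \<open>The trace is invariant under cyclic shifts: the last \<open>Ld\<close> moves
      to the front.\<close>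
    have 1: "trace (Ld ** L1 ** Ld) = trace (Ld ** Ld ** L1)"
      by (metis matrix_mul_assoc trace_mul_sym)
    have 2: "trace (Ld ** L1 ** Ld ** L1 ** Ld) = trace (Ld ** Ld ** L1 ** Ld ** L1)"
      by (metis matrix_mul_assoc trace_mul_sym)
    show ?thesis
      unfolding kirchhoff_index_eq_trace[OF LZ ZL JZ] Z_def
      by (simp add: trace_add trace_sub trace_matrix_scale trace_hd_matrix 1 2
          distrib_left right_diff_distrib ac_simps)
  qed
  ultimately show ?thesis
    using mp by (auto simp: Z_def)
qed

end
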